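(* Let $X_1,\dots,X_n$ be sub-independent real random variables with $X_i$ taking values in $[a_i,b_i]$ for $i=1,\dots,n$, where $\sum_{i=1}^n(b_i-a_i)^2>0$. Let $S_n=\sum_{i=1}^nX_i$. Then, for any $\varepsilon>0$, $$P(S_n-ES_n\ge\varepsilon)\le \exp\left(-\frac{2\varepsilon^2}{\sum_{i=1}^n(b_i-a_i)^2}\right)$$ and $$P(S_n-ES_n\le-\varepsilon)\le \exp\left(-\frac{2\varepsilon^2}{\sum_{i=1}^n(b_i-a_i)^2}\right).$$
   Context: Real random variables $X_1,\dots,X_n$ on a common probability space are called sub-independent if $E\,e^{it(X_1+\cdots+X_n)}=\prod_{i=1}^nE\,e^{itX_i}$ for all $t\in\mathbb{R}$ (equivalently, the law of $\sum_i X_i$ is the convolution of the laws of the $X_i$). *)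

theory Defs
  imports "HOL-Probability.Probability"
begin

(* Only the full sum over I is constrained, so sub-independence of a family need not
   pass to subfamilies. *)
definition (in prob_space) sub_independent :: "('i \<Rightarrow> 'a \<Rightarrow> real) \<Rightarrow> 'i set \<Rightarrow> bool" where
  "sub_independent X I \<longleftrightarrow>
     finite I \<and> (\<forall>i\<in>I. random_variable borel (X i)) \<and>
     (\<forall>t::real. (CLINT \<omega>|M. iexp (t * (\<Sum>i\<in>I. X i \<omega>)))
                  = (\<Prod>i\<in>I. (CLINT \<omega>|M. iexp (t * X i \<omega>))))"

end

theory Submission
  imports Defs
begin

text \<open>
  By Levy's uniqueness theorem, the sum of a sub-independent family has the same law as the sum of
  independent variables with the same marginals, namely the coordinates of the product of the
  marginal laws. Hoeffding's inequality only concerns the law of the sum and the marginals, so it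
  transfers from the independent family to the sub-independent one.
\<close>

text \<open>Independence amounts to the joint law being the product of the marginal laws. Points of
  \<open>PiM I D\<close> are extensional, so restricting them to \<open>I\<close> changes nothing
  and the joint law is \<open>PiM I D\<close> itself; its marginals are the factors
  \<open>D i\<close>.\<close>

lemma indep_vars_PiM_coordinates:
  assumes "\<And>i. i \<in> I \<Longrightarrow> prob_space (D i)" and "I \<noteq> {}"
  shows "prob_space.indep_vars (PiM I D) D (\<lambda>i \<omega>. \<omega> i) I"
proof -
  interpret P: prob_space "PiM I D"
    by (intro prob_space_PiM assms)
  have "distr (PiM I D) (PiM I D) (\<lambda>x. restrict x I) = distr (PiM I D) (PiM I D) (\<lambda>x. x)"
    by (intro distr_cong) (auto simp: space_PiM)
  also have "\<dots> = PiM I (\<lambda>i. distr (PiM I D) (D i) (\<lambda>x. x i))"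
    by (auto intro!: PiM_cong simp: distr_PiM_component assms)
  finally show ?thesis
    by (subst P.indep_vars_iff_distr_eq_PiM') (use assms in auto)
qed

text \<open>Both sums have as characteristic function the product of the marginal ones: on
  \<open>M\<close> by sub-independence, on \<open>N\<close> by genuine independence.\<close>

lemma (in prob_space) distr_sum_sub_independent:
  assumes sub: "sub_independent X I" and ne: "I \<noteq> {}"
  defines "N \<equiv> PiM I (\<lambda>i. distr M borel (X i))"
  shows "distr M borel (\<lambda>\<omega>. \<Sum>i\<in>I. X i \<omega>) = distr N borel (\<lambda>\<omega>. \<Sum>i\<in>I. \<omega> i)"
proof -
  have X [measurable]: "random_variable borel (X i)" if "i \<in> I" for i
    using sub that by (auto simp: sub_independent_def)
  have D: "prob_space (distr M borel (X i))" if "i \<in> I" for i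
    by (intro prob_space_distr X that)
  interpret N: prob_space N
    unfolding N_def by (intro prob_space_PiM D)
  have coord [measurable]: "(\<lambda>\<omega>. \<omega> i) \<in> borel_measurable N" if "i \<in> I" for i
    using measurable_component_singleton[OF that, of "\<lambda>i. distr M borel (X i)"] by (simp add: N_def)
  have "N.indep_vars (\<lambda>i. distr M borel (X i)) (\<lambda>i \<omega>. \<omega> i) I"
    unfolding N_def by (intro indep_vars_PiM_coordinates D ne)
  \<comment> \<open>Independence depends on the target spaces only through their sigma-algebras, and
    each marginal law lives on the Borel sets.\<close>
  then have indep: "N.indep_vars (\<lambda>_. borel) (\<lambda>i \<omega>. \<omega> i) I"
    by (simp add: N.indep_vars_def)
  have marginal: "distr N borel (\<lambda>\<omega>. \<omega> i) = distr M borel (X i)" if "i \<in> I" for i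
  proof -
    have "distr N borel (\<lambda>\<omega>. \<omega> i) = distr N (distr M borel (X i)) (\<lambda>\<omega>. \<omega> i)"
      by (intro distr_cong) auto
    also have "\<dots> = distr M borel (X i)"
      unfolding N_def by (intro distr_PiM_component D that)
    finally show ?thesis .
  qed
  show ?thesis
  proof (rule Levy_uniqueness)
    show "real_distribution (distr M borel (\<lambda>\<omega>. \<Sum>i\<in>I. X i \<omega>))"
      by (intro real_distribution_distr) measurable
    show "real_distribution (distr N borel (\<lambda>\<omega>. \<Sum>i\<in>I. \<omega> i))"
      by (intro N.real_distribution_distr) measurable
    show "char (distr M borel (\<lambda>\<omega>. \<Sum>i\<in>I. X i \<omega>)) = char (distr N borel (\<lambda>\<omega>. \<Sum>i\<in>I. \<omega> i))"
    proof
      fix t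
      have "char (distr M borel (\<lambda>\<omega>. \<Sum>i\<in>I. X i \<omega>)) t = (CLINT \<omega>|M. iexp (t * (\<Sum>i\<in>I. X i \<omega>)))"
        unfolding char_def by (intro integral_distr) measurable
      also have "\<dots> = (\<Prod>i\<in>I. CLINT \<omega>|M. iexp (t * X i \<omega>))"
        using sub by (simp add: sub_independent_def)
      also have "\<dots> = (\<Prod>i\<in>I. char (distr M borel (X i)) t)"
        unfolding char_def by (intro prod.cong refl integral_distr[symmetric]) measurable
      also have "\<dots> = (\<Prod>i\<in>I. char (distr N borel (\<lambda>\<omega>. \<omega> i)) t)"
        by (simp add: marginal)
      also have "\<dots> = char (distr N borel (\<lambda>\<omega>. \<Sum>i\<in>I. \<omega> i)) t"
        by (rule N.char_distr_sum[OF indep, symmetric])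
      finally show "char (distr M borel (\<lambda>\<omega>. \<Sum>i\<in>I. X i \<omega>)) t = char (distr N borel (\<lambda>\<omega>. \<Sum>i\<in>I. \<omega> i)) t" .
    qed
  qed
qed

theorem theorem6p1:
  fixes M :: "'a measure" and X :: "nat \<Rightarrow> 'a \<Rightarrow> real"
    and a b :: "nat \<Rightarrow> real" and n :: nat and \<epsilon> :: real
  assumes "prob_space M"
    and "prob_space.sub_independent M X {1..n}"
    and "\<And>i. i \<in> {1..n} \<Longrightarrow> AE \<omega> in M. X i \<omega> \<in> {a i..b i}"
    and "(\<Sum>i=1..n. (b i - a i)\<^sup>2) > 0"
    and "\<epsilon> > 0"
  shows "let S = (\<lambda>\<omega>. \<Sum>i=1..n. X i \<omega>); ES = (LINT \<omega>|M. S \<omega>) in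
           measure M {\<omega> \<in> space M. S \<omega> - ES \<ge> \<epsilon>}
             \<le> exp (- (2 * \<epsilon>\<^sup>2 / (\<Sum>i=1..n. (b i - a i)\<^sup>2)))
         \<and> measure M {\<omega> \<in> space M. S \<omega> - ES \<le> - \<epsilon>}
             \<le> exp (- (2 * \<epsilon>\<^sup>2 / (\<Sum>i=1..n. (b i - a i)\<^sup>2)))"
proof -
  interpret prob_space M by fact
  define I where "I = {1..n}"
  define S where "S = (\<lambda>\<omega>. \<Sum>i\<in>I. X i \<omega>)"
  define D where "D = (\<lambda>i. distr M borel (X i))"
  define N where "N = PiM I D"
  define T where "T = (\<lambda>\<omega>::nat \<Rightarrow> real. \<Sum>i\<in>I. \<omega> i)"
  define v where "v = (\<Sum>i\<in>I. (b i - a i)\<^sup>2)"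
  have v: "v > 0" using assms(4) by (simp add: v_def I_def)
  have fin: "finite I"
    by (simp add: I_def)
  \<comment> \<open>An empty index set would give \<open>v = 0\<close>.\<close>
  have ne: "I \<noteq> {}"
    using v by (auto simp: v_def)
  have bounded: "AE \<omega> in M. X i \<omega> \<in> {a i..b i}" if "i \<in> I" for i
    using assms(3) that by (simp add: I_def)
  have X [measurable]: "random_variable borel (X i)" if "i \<in> I" for i
    using assms(2) that by (auto simp: sub_independent_def I_def)
  have D: "prob_space (D i)" if "i \<in> I" for i
    unfolding D_def by (intro prob_space_distr X that)
  interpret N: prob_space N
    unfolding N_def by (intro prob_space_PiM D)
  have [measurable]: "(\<lambda>\<omega>. \<omega> i) \<in> borel_measurable N" if "i \<in> I" for i
    using measurable_component_singleton[OF that, of D] by (simp add: N_def D_def)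
  have [measurable]: "S \<in> borel_measurable M" "T \<in> borel_measurable N"
    unfolding S_def T_def by measurable
  have law: "distr M borel S = distr N borel T"
    using distr_sum_sub_independent[of X I] assms(2) ne by (simp add: S_def T_def N_def D_def I_def)
  have indep: "N.indep_vars (\<lambda>_. borel) (\<lambda>i \<omega>. \<omega> i) I"
    using indep_vars_PiM_coordinates[of I D, OF D ne, folded N_def] by (simp add: N.indep_vars_def D_def)
  \<comment> \<open>Almost sure bounds on \<open>X i\<close> are a property of its law
    \<open>D i\<close>, hence are inherited by the coordinate with that law.\<close>
  have N_bounded: "AE \<omega> in N. \<omega> i \<in> {a i..b i}" if "i \<in> I" for i
  proof -
    have "AE x in D i. x \<in> {a i..b i}"
      unfolding D_def using bounded[OF that] by (subst AE_distr_iff) (auto simp: X that)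
    then show ?thesis
      unfolding N_def by (intro AE_PiM_component[where P="\<lambda>x. x \<in> {a i..b i}"] D that)
  qed
  \<comment> \<open>The resulting bounds are centred at the sum of the coordinate means, which must
    then be identified with \<open>expectation S\<close>.\<close>
  interpret H: Hoeffding_ineq N I "\<lambda>i \<omega>. \<omega> i" a b "\<Sum>i\<in>I. N.expectation (\<lambda>\<omega>. \<omega> i)"
    by unfold_locales (use fin indep N_bounded in auto)
  have integrable: "integrable N (\<lambda>\<omega>. \<omega> i)" if "i \<in> I" for i
  proof -
    interpret interval_bounded_random_variable N "\<lambda>\<omega>. \<omega> i" "a i" "b i"
      using that by (rule H.bounded_random_variable)
    show ?thesis by (rule integrable)
  qed
  \<comment> \<open>Linearity is applied on \<open>N\<close>, where the bounded coordinates are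
    integrable. The passage to \<open>M\<close> compares only the sums: both expectations integrate
    the identity against the common law.\<close>
  have mean: "(\<Sum>i\<in>I. N.expectation (\<lambda>\<omega>. \<omega> i)) = expectation S"
  proof -
    have "(\<Sum>i\<in>I. N.expectation (\<lambda>\<omega>. \<omega> i)) = N.expectation T"
      unfolding T_def by (intro Bochner_Integration.integral_sum[symmetric] integrable)
    also have "\<dots> = integral\<^sup>L (distr N borel T) (\<lambda>x. x)"
      by (simp add: integral_distr)
    also have "\<dots> = expectation S"
      by (simp add: integral_distr flip: law)
    finally show ?thesis .
  qed
  have transfer: "prob {\<omega> \<in> space M. S \<omega> \<in> A} = N.prob {\<omega> \<in> space N. T \<omega> \<in> A}"
    if [measurable]: "A \<in> sets borel" for A
  proof -
    have "prob {\<omega> \<in> space M. S \<omega> \<in> A} = measure (distr M borel S) A"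
      by (simp add: measure_distr vimage_def Int_def conj_commute)
    also have "\<dots> = N.prob {\<omega> \<in> space N. T \<omega> \<in> A}"
      unfolding law by (simp add: measure_distr vimage_def Int_def conj_commute)
    finally show ?thesis .
  qed
  \<comment> \<open>Each deviation event says that \<open>S\<close> lies in a closed half-line, so
    its probability can be computed with \<open>T\<close>. Positivity of \<open>v\<close> meets the
    nondegeneracy condition of the Hoeffding bound.\<close>
  have "prob {\<omega> \<in> space M. S \<omega> - expectation S \<ge> \<epsilon>} \<le> exp (- (2 * \<epsilon>\<^sup>2 / v))"
    using transfer[of "{expectation S + \<epsilon>..}"] H.Hoeffding_ineq_ge[of \<epsilon>] v \<open>\<epsilon> > 0\<close>
    by (simp add: mean T_def v_def algebra_simps)
  moreover have "prob {\<omega> \<in> space M. S \<omega> - expectation S \<le> - \<epsilon>} \<le> exp (- (2 * \<epsilon>\<^sup>2 / v))"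
    using transfer[of "{..expectation S - \<epsilon>}"] H.Hoeffding_ineq_le[of \<epsilon>] v \<open>\<epsilon> > 0\<close>
    by (simp add: mean T_def v_def algebra_simps)
  ultimately show ?thesis
    by (simp add: S_def v_def I_def Let_def)
qed

end
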